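(* Let $L:\mathbb{R}^n\times\mathbb{R}^p\to[-\infty,+\infty]$ be a proper saddle function having a saddle point. Then any parallel Jacobi algorithm associated with the single-valued mapping $F=(I+T_L)^{-1}$ from $\mathbb{R}^n\times\mathbb{R}^p$ into $\mathbb{R}^n\times\mathbb{R}^p$ converges to a saddle point of $L$: for every starting point $z^0\in\mathbb{R}^n\times\mathbb{R}^p$, the sequence defined blockwise by $$z_i^{k+1}=F_i(z_1^k,\dots,z_\alpha^k),\qquad i=1,\dots,\alpha,\quad k=0,1,2,\dots$$ converges to a saddle point of $L$.
   Context: A function $L:\mathbb{R}^n\times\mathbb{R}^p\to[-\infty,+\infty]$ is called a saddle function if $L(x,y)$ is convex and lower semicontinuous in $x\in\mathbb{R}^n$ (for each $y$) and concave and upper semicontinuous in $y\in\mathbb{R}^p$ (for each $x$). It is proper (in Rockafellar's sense) if there exist $x_0\in\mathbb{R}^n$ with $L(x_0,y)<+\infty$ for all $y\in\mathbb{R}^p$ and $y_0\in\mathbb{R}^p$ with $L(x,y_0)>-\infty$ for all $x\in\mathbb{R}^n$. A saddle point of $L$ is an element $(x^*,y^* )\in\mathbb{R}^n\times\mathbb{R}^p$ with $$L(x^*,y)\le L(x^*,y^* )\le L(x,y^* )\quad\text{for all }(x,y)\in\mathbb{R}^n\times\mathbb{R}^p.$$ The multifunction $T_L$ on $\mathbb{R}^n\times\mathbb{R}^p$ is defined by: $(u,v)\in T_L(x,y)$ if and only if $$L(x,y')+\langle y'-y,v\rangle\le L(x,y)\le L(x',y)-\langle x'-x,u\rangle\quad\text{for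 all }(x',y')\in\mathbb{R}^n\times\mathbb{R}^p.$$ It is maximal monotone. The notation $w=(I+T_L)^{-1}z$ means $z\in w+T_L(w)$; this mapping is single-valued and everywhere defined. The space $\mathbb{R}^n\times\mathbb{R}^p$ carries the product inner product and is decomposed as a product of $\alpha\ge1$ mutually orthogonal blocks $\mathbb{R}^{n_i}$, the inner product being the sum of the block inner products; $z=(z_1,\dots,z_\alpha)$ and $F=(F_1,\dots,F_\alpha)$ are the corresponding block components. *)

theory Defs
  imports "HOL-Analysis.Analysis"
begin

text \<open>Convexity of an extended-real-valued function is convexity of its epigraph, which lies in
  the space times the (finite) reals; this avoids the expression \<open>\<infinity> - \<infinity>\<close>.\<close>

definition ereal_convex :: "('a::real_vector \<Rightarrow> ereal) \<Rightarrow> bool" where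
  "ereal_convex f \<longleftrightarrow> convex {(x, r :: real). f x \<le> ereal r}"

definition ereal_concave :: "('a::real_vector \<Rightarrow> ereal) \<Rightarrow> bool" where
  "ereal_concave f \<longleftrightarrow> ereal_convex (\<lambda>x. - f x)"

definition lower_semicont :: "('a::topological_space \<Rightarrow> ereal) \<Rightarrow> bool" where
  "lower_semicont f \<longleftrightarrow> (\<forall>x. f x \<le> Liminf (at x) f)"

definition upper_semicont :: "('a::topological_space \<Rightarrow> ereal) \<Rightarrow> bool" where
  "upper_semicont f \<longleftrightarrow> (\<forall>x. Limsup (at x) f \<le> f x)"

definition saddle_function ::
    "('a::euclidean_space \<Rightarrow> 'b::euclidean_space \<Rightarrow> ereal) \<Rightarrow> bool" where
  "saddle_function L \<longleftrightarrow>
     (\<forall>y. ereal_convex (\<lambda>x. L x y) \<and> lower_semicont (\<lambda>x. L x y)) \<and>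
     (\<forall>x. ereal_concave (L x) \<and> upper_semicont (L x))"

definition proper_saddle :: "('a \<Rightarrow> 'b \<Rightarrow> ereal) \<Rightarrow> bool" where
  "proper_saddle L \<longleftrightarrow> (\<exists>x0. \<forall>y. L x0 y < \<infinity>) \<and> (\<exists>y0. \<forall>x. L x y0 > - \<infinity>)"

definition saddle_point :: "('a \<Rightarrow> 'b \<Rightarrow> ereal) \<Rightarrow> 'a \<times> 'b \<Rightarrow> bool" where
  "saddle_point L = (\<lambda>(xs, ys). \<forall>x y. L xs y \<le> L xs ys \<and> L xs ys \<le> L x ys)"

definition saddle_op ::
    "('a::euclidean_space \<Rightarrow> 'b::euclidean_space \<Rightarrow> ereal) \<Rightarrow> 'a \<times> 'b \<Rightarrow> ('a \<times> 'b) set" where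
  "saddle_op L = (\<lambda>(x, y). {(u, v). \<forall>x' y'.
     L x y' + ereal ((y' - y) \<bullet> v) \<le> L x y \<and>
     L x y \<le> L x' y - ereal ((x' - x) \<bullet> u)})"

text \<open>The mapping \<open>(I + T)\<^sup>-\<^sup>1\<close>. The definite description is meaningful only where exactly one such
  \<open>w\<close> exists; that this is the case everywhere is a property of \<open>saddle_op L\<close> for a proper saddle
  function \<open>L\<close> and is not built into the definition.\<close>

definition resolvent :: "('e::real_vector \<Rightarrow> 'e set) \<Rightarrow> 'e \<Rightarrow> 'e" where
  "resolvent T z = (THE w. \<exists>t \<in> T w. z = w + t)"

text \<open>Since the block dimensions vary with \<open>i\<close>, the blocks are rendered as mutually orthogonal
  subspaces \<open>V 1, \<dots>, V \<alpha>\<close> that span the whole space; the block component \<open>z\<^sub>i\<close> is the orthogonal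
  projection onto \<open>V i\<close>, regarded as an element of the whole space.\<close>

definition block_decomposition :: "nat \<Rightarrow> (nat \<Rightarrow> 'e::euclidean_space set) \<Rightarrow> bool" where
  "block_decomposition \<alpha> V \<longleftrightarrow>
     \<alpha> \<ge> 1 \<and>
     (\<forall>i\<in>{1..\<alpha>}. subspace (V i)) \<and>
     (\<forall>i\<in>{1..\<alpha>}. \<forall>j\<in>{1..\<alpha>}. i \<noteq> j \<longrightarrow> (\<forall>u\<in>V i. \<forall>v\<in>V j. orthogonal u v)) \<and>
     span (\<Union>i\<in>{1..\<alpha>}. V i) = UNIV"

definition block_component :: "'e::euclidean_space set \<Rightarrow> 'e \<Rightarrow> 'e" where
  "block_component W z = (THE w. w \<in> W \<and> z - w \<in> W\<^sup>\<bottom>)"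

definition parallel_jacobi ::
    "nat \<Rightarrow> (nat \<Rightarrow> 'e::euclidean_space set) \<Rightarrow> ('e \<Rightarrow> 'e) \<Rightarrow> (nat \<Rightarrow> 'e) \<Rightarrow> bool" where
  "parallel_jacobi \<alpha> V F z \<longleftrightarrow>
     (\<forall>k. \<forall>i\<in>{1..\<alpha>}. block_component (V i) (z (Suc k)) = block_component (V i) (F (z k)))"

lemma parallel_jacobi_exists: "\<exists>z. z 0 = z0 \<and> parallel_jacobi \<alpha> V F z"
  by (rule exI[of _ "\<lambda>k. (F ^^ k) z0"]) (simp add: parallel_jacobi_def)

end

theory Submission
  imports Defs
begin

text \<open>All blocks are updated from the same iterate, so the Jacobi iteration is the proximal point
  iteration of \<open>saddle_op L\<close>. This operator is monotone, its resolvent is everywhere defined because a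
  proper saddle function perturbed by \<open>\<parallel>x - a\<parallel>\<^sup>2 / 2 - \<parallel>y - b\<parallel>\<^sup>2 / 2\<close> has a saddle point, and the
  resolvent is firmly nonexpansive. Hence the iterates approach every saddle point monotonically, their
  successive differences vanish, and any cluster point is a zero of the operator, i.e. a saddle
  point of \<open>L\<close>.\<close>

section \<open>Epigraphs of extended-real functions and their proximal points\<close>

definition ereal_epigraph :: "('a \<Rightarrow> ereal) \<Rightarrow> ('a \<times> real) set" where
  "ereal_epigraph f = {(x, r). f x \<le> ereal r}"

lemma mem_ereal_epigraph [simp]: "(x, r) \<in> ereal_epigraph f \<longleftrightarrow> f x \<le> ereal r"
  by (simp add: ereal_epigraph_def)

lemma ereal_convex_iff_epigraph: "ereal_convex f \<longleftrightarrow> convex (ereal_epigraph f)"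
  by (simp add: ereal_convex_def ereal_epigraph_def)

text \<open>A point below the graph leaves room for a real level strictly between it and
  \<open>f x\<close>; lower semicontinuity keeps \<open>f\<close> above that level near
  \<open>x\<close>, so the complement is open.\<close>

lemma closed_ereal_epigraph:
  fixes f :: "'a::topological_space \<Rightarrow> ereal"
  assumes "lower_semicont f"
  shows "closed (ereal_epigraph f)"
  unfolding closed_def
proof (subst open_subopen, intro ballI)
  fix p assume p: "p \<in> - ereal_epigraph f"
  obtain x r where xr: "p = (x, r)" by (cases p)
  with p have "ereal r < f x" by simp
  then obtain c where c: "ereal r < c" "c < f x" using dense by blast
  then obtain c' where c': "r < c'" "ereal c' < f x"
    by (cases c) auto
  have "\<forall>\<^sub>F y in at x. ereal c' < f y"
    using assms c'(2) unfolding lower_semicont_def le_Liminf_iff by blast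
  then obtain U where U: "open U" "x \<in> U" "\<And>y. y \<in> U \<Longrightarrow> y \<noteq> x \<Longrightarrow> ereal c' < f y"
    unfolding eventually_at_topological by blast
  have "U \<times> {..<c'} \<subseteq> - ereal_epigraph f"
  proof clarify
    fix y s assume "y \<in> U" "s < c'" "(y, s) \<in> ereal_epigraph f"
    moreover from this have "ereal c' < f y" using U(3) c'(2) by (cases "y = x") auto
    ultimately show False
      by (metis ereal_less_eq(3) less_le_not_le mem_ereal_epigraph order.strict_trans1)
  qed
  moreover have "open (U \<times> {..<c'})" "p \<in> U \<times> {..<c'}"
    using U c' xr by (auto intro: open_Times)
  ultimately show "\<exists>T. open T \<and> p \<in> T \<and> T \<subseteq> - ereal_epigraph f" by blast
qed

text \<open>An affine minorant of slope \<open>-c\<close>, obtained by separating a point below the graph,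
  makes the sublevel sets of \<open>r + \<parallel>x - a\<parallel>\<^sup>2 / 2\<close> compact, so this expression has a minimum
  on \<open>E\<close>; its first-order condition along segments is the claim.\<close>

lemma proximal_point_exists:
  fixes E :: "('a::euclidean_space \<times> real) set"
  assumes E: "closed E" "convex E" and in_E: "(p, s) \<in> E" and notin_E: "(p, s') \<notin> E" "s' < s"
  obtains x r where "(x, r) \<in> E" "\<And>x' r'. (x', r') \<in> E \<Longrightarrow> r + (x' - x) \<bullet> (a - x) \<le> r'"
proof -
  obtain n \<beta> where n: "n \<bullet> (p, s') < \<beta>" "\<And>q. q \<in> E \<Longrightarrow> \<beta> < n \<bullet> q"
    using separating_hyperplane_closed_point[OF E(2,1) notin_E(1)] by blast
  obtain n1 n2 where n12: "n = (n1, n2)" by (cases n)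
  \<comment> \<open>Both points lie over the same \<open>p\<close>, so the contributions of
    \<open>n1\<close> cancel: the separating hyperplane is not vertical.\<close>
  have "n2 * s' < n2 * s" using n(1) n(2)[OF in_E] by (simp add: n12)
  with notin_E(2) have n2: "0 < n2"
    by (metis less_eq_real_def linorder_not_le mult_less_cancel_left_disj order.asym)
  define c where "c = n1 /\<^sub>R n2"
  have minorant: "\<beta> / n2 - c \<bullet> x \<le> r" if "(x, r) \<in> E" for x r
    using n(2)[OF that] n2 by (simp add: n12 c_def field_simps)
  define q where "q = (\<lambda>(x, r). r + (norm (x - a))\<^sup>2 / 2 :: real)"
  define M where "M = q (p, s)"
  \<comment> \<open>Completing the square: on \<open>K\<close> the minorant forces \<open>x\<close>
    into the ball of radius \<open>sqrt (2 * R)\<close> about \<open>a + c\<close>.\<close>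
  define R where "R = M - \<beta> / n2 + c \<bullet> a + (norm c)\<^sup>2 / 2"
  define K where "K = E \<inter> {w. q w \<le> M}"
  have cont: "continuous_on S q" for S
    unfolding q_def case_prod_beta by (intro continuous_intros) auto
  have "norm w \<le> (norm (a + c) + sqrt (2 * R)) + (\<bar>M\<bar> + \<bar>\<beta> / n2\<bar> + norm c * (norm (a + c) + sqrt (2 * R)))"
    if "w \<in> K" for w
  proof -
    obtain x r where w: "w = (x, r)" by (cases w)
    have m: "\<beta> / n2 - c \<bullet> x \<le> r" "r + (norm (x - a))\<^sup>2 / 2 \<le> M"
      using minorant that by (auto simp: K_def q_def w)
    have "(norm (x - (a + c)))\<^sup>2 = (norm (x - a))\<^sup>2 - 2 * (c \<bullet> x) + 2 * (c \<bullet> a) + (norm c)\<^sup>2"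
      by (simp add: power2_norm_eq_inner algebra_simps inner_commute)
    also have "\<dots> \<le> 2 * R" using m by (simp add: R_def)
    finally have "norm (x - (a + c)) \<le> sqrt (2 * R)" by (rule real_le_rsqrt)
    then have x: "norm x \<le> norm (a + c) + sqrt (2 * R)"
      using norm_triangle_sub[of x "a + c"] by linarith
    have "\<bar>c \<bullet> x\<bar> \<le> norm c * (norm (a + c) + sqrt (2 * R))"
      by (rule order.trans[OF Cauchy_Schwarz_ineq2]) (intro mult_left_mono x norm_ge_zero)
    moreover have "r \<le> M" using m(2) zero_le_power2[of "norm (x - a)"] by linarith
    ultimately have "\<bar>r\<bar> \<le> \<bar>M\<bar> + \<bar>\<beta> / n2\<bar> + norm c * (norm (a + c) + sqrt (2 * R))"
      using m(1) by linarith
    then show ?thesis using x norm_Pair_le[of x r] by (simp add: w)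
  qed
  then have "bounded K" unfolding bounded_iff by blast
  moreover have "closed K" unfolding K_def
    by (intro closed_Int E closed_Collect_le cont continuous_on_const)
  ultimately have "compact K" by (simp add: compact_eq_bounded_closed)
  moreover have "(p, s) \<in> K" using in_E by (simp add: K_def M_def)
  ultimately obtain w where w: "w \<in> K" "\<And>w'. w' \<in> K \<Longrightarrow> q w \<le> q w'"
    using continuous_attains_inf[OF _ _ cont, of K] by blast
  obtain x r where xr: "w = (x, r)" by (cases w)
  have min: "q (x, r) \<le> q w'" if "w' \<in> E" for w'
    using w that by (cases "w' \<in> K") (auto simp: K_def xr)
  have xrE: "(x, r) \<in> E" using w by (simp add: K_def xr)
  have "r + (x' - x) \<bullet> (a - x) \<le> r'" if x': "(x', r') \<in> E" for x' r'
  proof -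
    \<comment> \<open>Minimality along the segment from \<open>(x, r)\<close> to
      \<open>(x', r')\<close>, divided by \<open>t\<close>; letting \<open>t\<close> decrease to 0
      removes the quadratic term.\<close>
    have "0 \<le> (r' - r - (x' - x) \<bullet> (a - x)) + t * ((norm (x' - x))\<^sup>2 / 2)" if t: "0 < t" "t \<le> 1" for t
    proof -
      have "(1 - t) *\<^sub>R (x, r) + t *\<^sub>R (x', r') \<in> E"
        using t by (intro convexD E xrE x') auto
      from min[OF this] have "0 \<le> t * (r' - r) +
          ((norm (((1 - t) *\<^sub>R x + t *\<^sub>R x') - a))\<^sup>2 - (norm (x - a))\<^sup>2) / 2"
        by (simp add: q_def algebra_simps diff_divide_distrib)
      also have "((1 - t) *\<^sub>R x + t *\<^sub>R x') - a = (x - a) + t *\<^sub>R (x' - x)"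
        by (simp add: algebra_simps)
      also have "(norm \<dots>)\<^sup>2 - (norm (x - a))\<^sup>2 = t * (2 * ((x' - x) \<bullet> (x - a)) + t * (norm (x' - x))\<^sup>2)"
        unfolding power2_norm_eq_inner
        by (simp add: inner_add_left inner_add_right inner_commute algebra_simps)
      also have "t * (r' - r) + t * (2 * ((x' - x) \<bullet> (x - a)) + t * (norm (x' - x))\<^sup>2) / 2
          = t * ((r' - r - (x' - x) \<bullet> (a - x)) + t * ((norm (x' - x))\<^sup>2 / 2))"
        by (simp add: inner_diff_right field_simps)
      finally show ?thesis using t by (simp add: zero_le_mult_iff)
    qed
    then have "\<forall>\<^sub>F t in at_right 0. 0 \<le> (r' - r - (x' - x) \<bullet> (a - x)) + t * ((norm (x' - x))\<^sup>2 / 2)"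
      unfolding eventually_at_right_field by (metis less_eq_real_def zero_less_one)
    moreover have "((\<lambda>t. (r' - r - (x' - x) \<bullet> (a - x)) + t * ((norm (x' - x))\<^sup>2 / 2)) \<longlongrightarrow>
        (r' - r - (x' - x) \<bullet> (a - x)) + 0 * ((norm (x' - x))\<^sup>2 / 2)) (at_right 0)"
      by (intro tendsto_intros)
    ultimately have "0 \<le> (r' - r - (x' - x) \<bullet> (a - x)) + 0 * ((norm (x' - x))\<^sup>2 / 2)"
      by (intro tendsto_lowerbound) auto
    then show ?thesis by simp
  qed
  with xrE that show thesis by blast
qed

text \<open>Segments run from a point of the epigraph over \<open>x\<close> to points far down over
  \<open>p\<close>, where every height is admissible. They pass at the prescribed height
  \<open>s\<close> arbitrarily close to \<open>x\<close>, and closedness puts \<open>(x, s)\<close>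
  into the epigraph.\<close>

lemma closed_convex_improper:
  fixes f :: "'a::real_normed_vector \<Rightarrow> ereal"
  assumes closed: "closed (ereal_epigraph f)" and convex: "convex (ereal_epigraph f)"
    and "f p = - \<infinity>" "f x < \<infinity>"
  shows "f x = - \<infinity>"
proof (rule ereal_bot)
  fix s :: real
  obtain r where r: "(x, r) \<in> ereal_epigraph f"
    using assms(4) by (cases "f x") auto
  define X where "X n = (x + (1 / real (Suc n)) *\<^sub>R (p - x), s)" for n :: nat
  have X: "X n \<in> ereal_epigraph f" for n
  proof -
    define t where "t = 1 / real (Suc n)"
    have t: "0 < t" "t \<le> 1" by (auto simp: t_def)
    \<comment> \<open>The height over \<open>p\<close> is solved for so that the convex combination
      has height exactly \<open>s\<close>.\<close>
    have "(1 - t) *\<^sub>R (x, r) + t *\<^sub>R (p, (s - (1 - t) * r) / t) \<in> ereal_epigraph f"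
      using t assms(3) by (intro convexD convex r) auto
    also have "(1 - t) *\<^sub>R (x, r) + t *\<^sub>R (p, (s - (1 - t) * r) / t) = X n"
      unfolding X_def t_def[symmetric] using t by simp (simp add: algebra_simps)
    finally show ?thesis .
  qed
  moreover have "X \<longlonglongrightarrow> (x + 0 *\<^sub>R (p - x), s)"
    unfolding X_def by (intro tendsto_intros LIMSEQ_Suc[OF lim_1_over_n])
  ultimately have "(x + 0 *\<^sub>R (p - x), s) \<in> ereal_epigraph f"
    using closed_sequentially[OF closed] by blast
  then show "f x \<le> ereal s" by simp
qed

text \<open>The linear term is the one in the first-order condition of a proximal point; the
  remainder is the quadratic growth around the minimiser.\<close>

lemma norm_diff_sq_expand:
  fixes a x x' :: "'a::real_inner"
  shows "(norm (x' - a))\<^sup>2 / 2 = (norm (x - a))\<^sup>2 / 2 - (x' - x) \<bullet> (a - x) + (norm (x' - x))\<^sup>2 / 2"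
  by (simp add: power2_norm_eq_inner algebra_simps inner_commute add_divide_distrib diff_divide_distrib)

section \<open>Saddle functions and the solvability of the resolvent equation\<close>

lemma saddle_function_epigraphs:
  assumes "saddle_function L"
  shows "closed (ereal_epigraph (\<lambda>x. L x y))" "convex (ereal_epigraph (\<lambda>x. L x y))"
    "closed (ereal_epigraph (\<lambda>y. - L x y))" "convex (ereal_epigraph (\<lambda>y. - L x y))"
proof -
  have "lower_semicont (\<lambda>y. - L x y)"
    using assms by (simp add: saddle_function_def upper_semicont_def lower_semicont_def
        ereal_Liminf_uminus)
  then show "closed (ereal_epigraph (\<lambda>y. - L x y))" by (rule closed_ereal_epigraph)
qed (use assms in \<open>simp_all add: saddle_function_def closed_ereal_epigraph ereal_concave_def
    ereal_convex_iff_epigraph\<close>)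

text \<open>The resolvent at \<open>(a, b)\<close> is the saddle point of
  \<open>L x y + \<parallel>x - a\<parallel>\<^sup>2 / 2 - \<parallel>y - b\<parallel>\<^sup>2 / 2\<close>. Its \<open>y\<close>-part is the proximal point
  of \<open>H y = (SUP x. - L x y - \<parallel>x - a\<parallel>\<^sup>2 / 2)\<close> at \<open>b\<close>, its \<open>x\<close>-part the proximal point of
  \<open>\<lambda>x. L x y\<close> at \<open>a\<close>. To see that the pair is a saddle point, move \<open>y\<close> by a small step towards an arbitrary
  competitor: by strong convexity the corresponding minimisers in \<open>x\<close> converge.\<close>

lemma saddle_op_range:
  fixes L :: "'a::euclidean_space \<Rightarrow> 'b::euclidean_space \<Rightarrow> ereal"
  assumes saddle: "saddle_function L" and proper: "proper_saddle L"
  shows "\<exists>w. \<exists>t\<in>saddle_op L w. z = w + t"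
proof -
  obtain a b where z: "z = (a, b)" by (cases z)
  obtain x0 y0 where x0: "\<And>y. L x0 y < \<infinity>" and y0: "\<And>x. L x y0 > - \<infinity>"
    using proper by (auto simp: proper_saddle_def)
  note epi = saddle_function_epigraphs[OF saddle]
  define q where "q x = (norm (x - a))\<^sup>2 / 2" for x
  define D where "D = {y. \<forall>x. L x y > - \<infinity>}"
  \<comment> \<open>Minimality of \<open>x\<close> for \<open>L x y + q x\<close> in the strong form
    with quadratic growth, which later forces the minimisers for nearby second arguments to
    converge.\<close>
  define prox where "prox y x l \<longleftrightarrow> L x y = ereal l \<and>
    (\<forall>x' r'. L x' y \<le> ereal r' \<longrightarrow> l + q x + (norm (x' - x))\<^sup>2 / 2 \<le> r' + q x')" for y x l
  have prox_exists: "\<exists>x l. prox y x l" if y: "y \<in> D" for y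
  proof -
    have fin: "L x y > - \<infinity>" for x using y by (auto simp: D_def)
    from fin[of x0] x0[of y] obtain r0 where "L x0 y = ereal r0" by (cases "L x0 y") auto
    then have "(x0, r0) \<in> ereal_epigraph (\<lambda>x. L x y)" "(x0, r0 - 1) \<notin> ereal_epigraph (\<lambda>x. L x y)"
      by auto
    from proximal_point_exists[OF epi(1,2) this, of a] obtain x r where xr:
      "(x, r) \<in> ereal_epigraph (\<lambda>x. L x y)"
      "\<And>x' r'. (x', r') \<in> ereal_epigraph (\<lambda>x. L x y) \<Longrightarrow> r + (x' - x) \<bullet> (a - x) \<le> r'"
      by auto
    from xr(1) fin[of x] obtain l where l: "L x y = ereal l" by (cases "L x y") auto
    with xr(1) xr(2)[of x l] have "r = l" by simp
    have "l + q x + (norm (x' - x))\<^sup>2 / 2 \<le> r' + q x'" if "L x' y \<le> ereal r'" for x' r'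
      unfolding q_def norm_diff_sq_expand[of x' a x] using xr(2)[of x' r'] that \<open>r = l\<close> by simp
    with l have "prox y x l" unfolding prox_def by blast
    then show ?thesis by blast
  qed
  \<comment> \<open>The epigraph of the marginal function \<open>SUP x. - L x y - q x\<close>,
    stated without a supremum; as an intersection of vertically translated epigraphs it is closed
    and convex.\<close>
  define H where "H = {(y, r). \<forall>x. - L x y \<le> ereal (r + q x)}"
  have H_eq: "H = (\<Inter>x. (\<lambda>(y, r). (y, r + q x)) -` ereal_epigraph (\<lambda>y. - L x y))"
    by (auto simp: H_def)
  have closedH: "closed H" unfolding H_eq case_prod_beta
    by (intro closed_INT ballI closed_vimage epi continuous_intros)
  have convexH: "convex H" unfolding H_eq
  proof (intro convex_INT convexI)
    fix x w w' and u v :: real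
    assume *: "w \<in> (\<lambda>(y, r). (y, r + q x)) -` ereal_epigraph (\<lambda>y. - L x y)"
      "w' \<in> (\<lambda>(y, r). (y, r + q x)) -` ereal_epigraph (\<lambda>y. - L x y)"
      and uv: "0 \<le> u" "0 \<le> v" "u + v = 1"
    obtain y r y' r' where w: "w = (y, r)" "w' = (y', r')" by (cases w, cases w')
    have "u *\<^sub>R (y, r + q x) + v *\<^sub>R (y', r' + q x) \<in> ereal_epigraph (\<lambda>y. - L x y)"
      using * uv w by (intro convexD epi) auto
    moreover have "u * (r + q x) + v * (r' + q x) = u * r + v * r' + (u + v) * q x"
      by (simp add: algebra_simps)
    ultimately show "u *\<^sub>R w + v *\<^sub>R w' \<in> (\<lambda>(y, r). (y, r + q x)) -` ereal_epigraph (\<lambda>y. - L x y)"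
      using uv(3) by (simp add: w)
  qed
  have H_D: "y \<in> D" if yr: "(y, r) \<in> H" for y r
    unfolding D_def
  proof clarify
    fix x
    from yr have "- L x y \<le> ereal (r + q x)" by (auto simp: H_def)
    then show "L x y > - \<infinity>" by (cases "L x y") auto
  qed
  have prox_H: "(y, - (l + q x)) \<in> H" if p: "prox y x l" and y: "y \<in> D" for x y l
    unfolding H_def
  proof clarify
    fix x'
    show "- L x' y \<le> ereal (- (l + q x) + q x')"
    proof (cases "L x' y")
      case (real r')
      with p have "l + q x + (norm (x' - x))\<^sup>2 / 2 \<le> r' + q x'" by (simp add: prox_def)
      moreover have "0 \<le> (norm (x' - x))\<^sup>2 / 2" by simp
      ultimately have "- r' \<le> - (l + q x) + q x'" by linarith
      then show ?thesis using real by simp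
    qed (use y in \<open>auto simp: D_def\<close>)
  qed
  have H_prox: "- (l + q x) \<le> r" if "prox y x l" "(y, r) \<in> H" for x y l r
  proof -
    have "- L x y \<le> ereal (r + q x)" using that(2) by (auto simp: H_def)
    with that(1) show ?thesis by (simp add: prox_def)
  qed

  have y0D: "y0 \<in> D" using y0 by (simp add: D_def)
  then obtain x1 l1 where "prox y0 x1 l1" using prox_exists by blast
  then have H0: "(y0, - (l1 + q x1)) \<in> H" using y0D prox_H by blast
  obtain l0 where l0: "L x0 y0 = ereal l0" using x0[of y0] y0[of x0] by (cases "L x0 y0") auto
  \<comment> \<open>The first bound keeps \<open>(y0, s0)\<close> out of \<open>H\<close> through
    the test point \<open>x0\<close>; the second puts it below the known point of
    \<open>H\<close>.\<close>
  define s0 where "s0 = min (- (l0 + q x0) - 1) (- (l1 + q x1) - 1)"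
  have "\<not> - L x0 y0 \<le> ereal (s0 + q x0)" by (simp add: l0 s0_def)
  then have H0': "(y0, s0) \<notin> H" by (auto simp: H_def)
  have "s0 < - (l1 + q x1)" by (simp add: s0_def)
  from proximal_point_exists[OF closedH convexH H0 H0' this, of b] obtain y r where
    yr: "(y, r) \<in> H" and min: "\<And>y' r'. (y', r') \<in> H \<Longrightarrow> r + (y' - y) \<bullet> (b - y) \<le> r'" by auto
  have yD: "y \<in> D" using H_D yr .
  then obtain x l where p: "prox y x l" using prox_exists by blast
  have r: "r = - (l + q x)"
    using H_prox[OF p yr] min[OF prox_H[OF p yD]] by simp
  have Lxy: "L x y = ereal l" using p by (simp add: prox_def)
  \<comment> \<open>Otherwise the closed convex function \<open>- L x\<close> would take the value
    -\<infinity>, although it is finite at \<open>y\<close>.\<close>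
  have xC: "L x y' < \<infinity>" for y'
  proof (rule ccontr)
    assume "\<not> L x y' < \<infinity>"
    then have "- L x y' = - \<infinity>" by simp
    then show False
      using closed_convex_improper[OF epi(3,4)[of x], of y' y] Lxy by simp
  qed
  have 1: "L x y \<le> L x' y - ereal ((x' - x) \<bullet> (a - x))" for x'
  proof -
    have "l + (x' - x) \<bullet> (a - x) \<le> r'" if r': "L x' y = ereal r'" for r'
    proof -
      have "l + q x + (norm (x' - x))\<^sup>2 / 2 \<le> r' + q x'"
        using p r' by (simp add: prox_def)
      then show ?thesis unfolding q_def norm_diff_sq_expand[of x' a x] by simp
    qed
    moreover have "L x' y > - \<infinity>" using yD by (simp add: D_def)
    ultimately show ?thesis by (cases "L x' y") (auto simp: Lxy le_diff_eq)
  qed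
  have 2: "L x y' + ereal ((y' - y) \<bullet> (b - y)) \<le> L x y" for y'
  proof (cases "y' \<in> D")
    case False
    then obtain x' where "L x' y' = - \<infinity>" by (auto simp: D_def)
    then have "L x y' = - \<infinity>" using closed_convex_improper[OF epi(1,2)] xC by blast
    then show ?thesis by simp
  next
    case True
    then obtain x' l' where p': "prox y' x' l'" using prox_exists by blast
    define d where "d = (y' - y) \<bullet> (b - y)"
    \<comment> \<open>The shift by 2 keeps \<open>t n\<close> strictly between 0 and 1 and gives
      \<open>1 - t n = t n * real (n + 1)\<close>, the source of the rate below.\<close>
    define t where "t n = 1 / real (n + 2)" for n
    have t: "0 < t n" "t n < 1" for n by (auto simp: t_def)
    define Y where "Y n = (1 - t n) *\<^sub>R y + t n *\<^sub>R y'" for n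
    have "(Y n, (1 - t n) * r + t n * (- (l' + q x'))) \<in> H" for n
    proof -
      have "(1 - t n) *\<^sub>R (y, r) + t n *\<^sub>R (y', - (l' + q x')) \<in> H"
        using t[of n] by (intro convexD[OF convexH yr prox_H[OF p' True]]) auto
      then show ?thesis by (simp add: Y_def)
    qed
    then have YD: "Y n \<in> D" for n using H_D by blast
    then have "\<exists>X l. prox (Y n) X l" for n using prox_exists by blast
    then obtain X lX where pX: "\<And>n. prox (Y n) (X n) (lX n)" by metis
    \<comment> \<open>The bound sought for \<open>L x y'\<close> is \<open>l - d\<close>, that is
      \<open>k - q x\<close>; it is first shown with \<open>X n\<close> in place of
      \<open>x\<close>.\<close>
    define k where "k = l + q x - d"
    have step: "L (X n) y' \<le> ereal (k - q (X n))"
         "(norm (X n - x))\<^sup>2 \<le> 2 * (k - (l' + q x')) * (1 / real (n + 1))" for n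
    proof -
      have "L (X n) (Y n) = ereal (lX n)" using pX[of n] by (simp add: prox_def)
      then have XC: "L (X n) v < \<infinity>" for v
        using closed_convex_improper[OF epi(3,4)[of "X n"], of v "Y n"]
        by (cases "L (X n) v") auto
      have "L (X n) y > - \<infinity>" "L (X n) y' > - \<infinity>" using yD True by (auto simp: D_def)
      with XC[of y] XC[of y'] obtain m m' where m: "L (X n) y = ereal m" "L (X n) y' = ereal m'"
        by (cases "L (X n) y"; cases "L (X n) y'") auto
      have "(1 - t n) *\<^sub>R (y, - m) + t n *\<^sub>R (y', - m') \<in> ereal_epigraph (\<lambda>y. - L (X n) y)"
        using t[of n] m by (intro convexD[OF epi(4)]) auto
      then have concave: "(1 - t n) * m + t n * m' \<le> lX n"
        using \<open>L (X n) (Y n) = ereal (lX n)\<close> by (simp add: Y_def)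
      have "r + (Y n - y) \<bullet> (b - y) \<le> - (lX n + q (X n))"
        using min[OF prox_H[OF pX YD]] .
      moreover have "Y n - y = t n *\<^sub>R (y' - y)" by (simp add: Y_def algebra_simps)
      ultimately have "lX n + q (X n) \<le> (l + q x) - t n * d" by (simp add: r d_def)
      moreover have "l + q x + (norm (X n - x))\<^sup>2 / 2 \<le> m + q (X n)"
        using p m(1) by (simp add: prox_def)
      then have "(1 - t n) * (l + q x + (norm (X n - x))\<^sup>2 / 2) \<le> (1 - t n) * (m + q (X n))"
        using t[of n] by (intro mult_left_mono) auto
      \<comment> \<open>Concavity of \<open>L (X n)\<close>, minimality of \<open>y\<close> and
        quadratic growth at \<open>x\<close> combine so that everything except the distance term
        carries a factor \<open>t n\<close>.\<close>
      ultimately have main: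
        "t n * (m' + q (X n)) + (1 - t n) * ((norm (X n - x))\<^sup>2 / 2) \<le> t n * k"
        using concave unfolding k_def by (simp add: algebra_simps)
      moreover have "0 \<le> (1 - t n) * ((norm (X n - x))\<^sup>2 / 2)" using t[of n] by simp
      ultimately have "t n * (m' + q (X n)) \<le> t n * k" by linarith
      then have "m' + q (X n) \<le> k" using t[of n] by simp
      then show "L (X n) y' \<le> ereal (k - q (X n))" using m by simp
      \<comment> \<open>Growth at \<open>y'\<close> bounds \<open>m' + q (X n)\<close> below
        independently of \<open>n\<close>, so \<open>main\<close> forces the distance term to
        vanish.\<close>
      have "l' + q x' + (norm (X n - x'))\<^sup>2 / 2 \<le> m' + q (X n)"
        using p' m(2) by (simp add: prox_def)
      moreover have "0 \<le> (norm (X n - x'))\<^sup>2 / 2" by simp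
      ultimately have "l' + q x' \<le> m' + q (X n)" by linarith
      then have "t n * (l' + q x') \<le> t n * (m' + q (X n))"
        using t[of n] by (intro mult_left_mono) auto
      with main have "(1 - t n) * ((norm (X n - x))\<^sup>2 / 2) \<le> t n * (k - (l' + q x'))"
        by (simp add: algebra_simps)
      moreover have "1 - t n = t n * real (n + 1)" by (simp add: t_def field_simps)
      ultimately have "t n * (real (n + 1) * ((norm (X n - x))\<^sup>2 / 2)) \<le> t n * (k - (l' + q x'))"
        by (simp only: mult.assoc)
      then have "real (n + 1) * ((norm (X n - x))\<^sup>2 / 2) \<le> k - (l' + q x')"
        using t[of n] by simp
      then show "(norm (X n - x))\<^sup>2 \<le> 2 * (k - (l' + q x')) * (1 / real (n + 1))"
        by (simp add: field_simps)
    qed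
    have "(\<lambda>n. 1 / real (n + 1)) \<longlonglongrightarrow> 0"
      using LIMSEQ_Suc[OF lim_1_over_n[where 'a = real]] by (simp only: Suc_eq_plus1)
    from tendsto_mult_right_zero[OF this]
    have "(\<lambda>n. 2 * (k - (l' + q x')) * (1 / real (n + 1))) \<longlonglongrightarrow> 0" .
    then have "(\<lambda>n. (norm (X n - x))\<^sup>2) \<longlonglongrightarrow> 0"
      by (rule tendsto_sandwich[OF always_eventually always_eventually tendsto_const, rotated 2])
        (rule allI, rule zero_le_power2, rule allI, rule step(2))
    then have "(\<lambda>n. X n - x) \<longlonglongrightarrow> 0"
      by (simp add: tendsto_norm_zero_iff power_tendsto_0_iff)
    then have "X \<longlonglongrightarrow> x" by (simp add: LIM_zero_iff)
    then have "(\<lambda>n. (X n, k - q (X n))) \<longlonglongrightarrow> (x, k - q x)"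
      unfolding q_def by (intro tendsto_intros) auto
    moreover have "(X n, k - q (X n)) \<in> ereal_epigraph (\<lambda>x. L x y')" for n
      using step(1) by simp
    ultimately have "(x, k - q x) \<in> ereal_epigraph (\<lambda>x. L x y')"
      by (rule closed_sequentially[OF epi(1), rotated])
    then have "L x y' \<le> ereal (l - d)" by (simp add: k_def)
    then show ?thesis by (cases "L x y'") (auto simp: Lxy d_def)
  qed
  have "(a - x, b - y) \<in> saddle_op L (x, y)" using 1 2 by (simp add: saddle_op_def)
  moreover have "z = (x, y) + (a - x, b - y)" by (simp add: z)
  ultimately show ?thesis by blast
qed

section \<open>Monotonicity of the saddle operator\<close>

lemma saddle_op_finite:
  assumes "proper_saddle L" "(u, v) \<in> saddle_op L (x, y)"
  shows "\<bar>L x y\<bar> \<noteq> \<infinity>"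
proof -
  obtain x0 y0 where x0: "\<And>y. L x0 y < \<infinity>" and y0: "\<And>x. L x y0 > - \<infinity>"
    using assms(1) by (auto simp: proper_saddle_def)
  \<comment> \<open>Testing at \<open>y0\<close> excludes the value -\<infinity>, testing at
    \<open>x0\<close> the value \<infinity>.\<close>
  have "L x y0 + ereal ((y0 - y) \<bullet> v) \<le> L x y" "L x y \<le> L x0 y - ereal ((x0 - x) \<bullet> u)"
    using assms(2) by (auto simp: saddle_op_def)
  then show ?thesis using x0[of y] y0[of x]
    by (cases "L x y"; cases "L x0 y"; cases "L x y0") auto
qed

text \<open>Each pair is tested at the other point. Finite values at \<open>w\<close> and
  \<open>w'\<close> make the cross values finite, so all values of \<open>L\<close> cancel in the
  sum of the four inequalities.\<close>

lemma saddle_op_monotone: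
  assumes proper: "proper_saddle L" and t: "t \<in> saddle_op L w" and t': "t' \<in> saddle_op L w'"
  shows "0 \<le> (w - w') \<bullet> (t - t')"
proof -
  obtain x y u v where w: "w = (x, y)" "t = (u, v)" by (cases w, cases t)
  obtain x' y' u' v' where w': "w' = (x', y')" "t' = (u', v')" by (cases w', cases t')
  have "L x y' + ereal ((y' - y) \<bullet> v) \<le> L x y" "L x y \<le> L x' y - ereal ((x' - x) \<bullet> u)"
    "L x' y + ereal ((y - y') \<bullet> v') \<le> L x' y'" "L x' y' \<le> L x y' - ereal ((x - x') \<bullet> u')"
    using t t' by (auto simp: saddle_op_def w w')
  moreover have "\<bar>L x y\<bar> \<noteq> \<infinity>" "\<bar>L x' y'\<bar> \<noteq> \<infinity>"
    using saddle_op_finite[OF proper] t t' by (auto simp: w w')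
  moreover from this obtain r r' where "L x y = ereal r" "L x' y' = ereal r'" by auto
  ultimately have "(y' - y) \<bullet> v + (x' - x) \<bullet> u + (y - y') \<bullet> v' + (x - x') \<bullet> u' \<le> 0"
    by (cases "L x y'"; cases "L x' y") auto
  then show ?thesis by (simp add: w w' algebra_simps)
qed

lemma saddle_point_iff: "saddle_point L w \<longleftrightarrow> 0 \<in> saddle_op L w"
  by (cases w) (auto simp: saddle_point_def saddle_op_def zero_prod_def)

text \<open>Maximality is expressed in Minty's form, surjectivity of \<open>I + T\<close>: it gives
  existence of the resolvent value, while monotonicity gives uniqueness.\<close>

locale maximal_monotone =
  fixes T :: "'e::euclidean_space \<Rightarrow> 'e set"
  assumes monotone: "\<And>w w' t t'. t \<in> T w \<Longrightarrow> t' \<in> T w' \<Longrightarrow> 0 \<le> (w - w') \<bullet> (t - t')"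
    and range: "\<And>z. \<exists>w. \<exists>t\<in>T w. z = w + t"
begin

section \<open>Resolvents and the proximal point iteration\<close>

lemma resolvent_eqI:
  assumes t: "t \<in> T w"
  shows "resolvent T (w + t) = w"
  unfolding resolvent_def
proof (rule the_equality)
  fix w' assume "\<exists>t'\<in>T w'. w + t = w' + t'"
  then obtain t' where t': "t' \<in> T w'" "w + t = w' + t'" by blast
  \<comment> \<open>Subtracting the two representations of one point turns monotonicity into
    nonnegativity of \<open>- (norm (w - w'))\<^sup>2\<close>.\<close>
  then have "t' - t = w - w'" by (simp add: algebra_simps)
  with monotone[OF t'(1) t] have "0 \<le> (w' - w) \<bullet> (w - w')" by simp
  also have "\<dots> = - (norm (w - w'))\<^sup>2"
    by (simp add: power2_norm_eq_inner inner_diff_left inner_diff_right inner_commute)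
  finally show "w' = w" by simp
qed (use t in blast)

lemma resolvent_mem: "z - resolvent T z \<in> T (resolvent T z)"
  using range[of z] resolvent_eqI by fastforce

lemma resolvent_fixpoint_iff: "resolvent T w = w \<longleftrightarrow> 0 \<in> T w"
  using resolvent_mem[of w] resolvent_eqI[of 0 w] by auto

text \<open>Monotonicity makes the inner product of the resolvent difference \<open>p\<close> and
  the residual difference \<open>s\<close> nonnegative; expand the square of
  \<open>p + s\<close>.\<close>

lemma firmly_nonexpansive:
  "(norm (resolvent T z - resolvent T z'))\<^sup>2
    + (norm ((z - resolvent T z) - (z' - resolvent T z')))\<^sup>2 \<le> (norm (z - z'))\<^sup>2"
proof -
  define p s where "p = resolvent T z - resolvent T z'"
    and "s = (z - resolvent T z) - (z' - resolvent T z')"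
  have "0 \<le> p \<bullet> s" unfolding p_def s_def by (intro monotone resolvent_mem)
  moreover have "z - z' = p + s" by (simp add: p_def s_def)
  ultimately show ?thesis unfolding p_def[symmetric] s_def[symmetric]
    by (simp add: power2_norm_eq_inner inner_add_left inner_add_right inner_commute)
qed

lemma resolvent_nonexpansive: "norm (resolvent T z - resolvent T z') \<le> norm (z - z')"
proof (rule power2_le_imp_le)
  show "(norm (resolvent T z - resolvent T z'))\<^sup>2 \<le> (norm (z - z'))\<^sup>2"
    using firmly_nonexpansive[of z z']
      zero_le_power2[of "norm ((z - resolvent T z) - (z' - resolvent T z'))"] by linarith
qed simp

lemma continuous_resolvent: "isCont (resolvent T) z"
proof -
  have "1-lipschitz_on UNIV (resolvent T)"
    by (rule lipschitz_onI) (simp_all add: dist_norm resolvent_nonexpansive)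
  then show ?thesis
    using lipschitz_on_continuous_on continuous_on_eq_continuous_at[OF open_UNIV] by blast
qed

text \<open>The distance to every zero of \<open>T\<close> decreases (Fejer monotonicity), and so does the distance to
  the limit of a convergent subsequence once that limit is known to be a zero.\<close>

theorem proximal_point_iteration_converges:
  assumes step: "\<And>k. z (Suc k) = resolvent T (z k)" and zero: "0 \<in> T w0"
  shows "\<exists>w. 0 \<in> T w \<and> z \<longlonglongrightarrow> w"
proof -
  have fejer: "(norm (z (Suc k) - w))\<^sup>2 + (norm (z k - z (Suc k)))\<^sup>2 \<le> (norm (z k - w))\<^sup>2"
    if "0 \<in> T w" for w k
    using firmly_nonexpansive[of "z k" w] that
    by (simp add: step resolvent_fixpoint_iff[symmetric])
  have decreasing: "decseq (\<lambda>k. norm (z k - w))" if "0 \<in> T w" for w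
  proof (rule decseq_SucI, rule power2_le_imp_le)
    fix k show "(norm (z (Suc k) - w))\<^sup>2 \<le> (norm (z k - w))\<^sup>2"
      using fejer[OF that, of k] zero_le_power2[of "norm (z k - z (Suc k))"] by linarith
  qed simp
  have "summable (\<lambda>k. (norm (z k - z (Suc k)))\<^sup>2)"
  proof (rule bounded_imp_summable)
    fix n
    have "(\<Sum>k\<le>n. (norm (z k - z (Suc k)))\<^sup>2) \<le> (\<Sum>k\<le>n. (norm (z k - w0))\<^sup>2 - (norm (z (Suc k) - w0))\<^sup>2)"
      using fejer[OF zero] by (intro sum_mono) (simp add: algebra_simps)
    also have "\<dots> = (norm (z 0 - w0))\<^sup>2 - (norm (z (Suc n) - w0))\<^sup>2"
      by (rule sum_telescope)
    finally show "(\<Sum>k\<le>n. (norm (z k - z (Suc k)))\<^sup>2) \<le> (norm (z 0 - w0))\<^sup>2"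
      using zero_le_power2[of "norm (z (Suc n) - w0)"] by linarith
  qed simp
  then have "(\<lambda>k. (norm (z k - z (Suc k)))\<^sup>2) \<longlonglongrightarrow> 0" by (rule summable_LIMSEQ_zero)
  then have diff: "(\<lambda>k. z k - resolvent T (z k)) \<longlonglongrightarrow> 0"
    by (simp add: tendsto_norm_zero_iff power_tendsto_0_iff step)
  have "norm (z k) \<le> norm (z 0 - w0) + norm w0" for k
    using decseqD[OF decreasing[OF zero], of 0 k] norm_triangle_sub[of "z k" w0] by simp
  then have "bounded (range z)" unfolding bounded_iff by auto
  then obtain w f where f: "strict_mono f" "(z \<circ> f) \<longlonglongrightarrow> w"
    using bounded_imp_convergent_subsequence by blast
  \<comment> \<open>Continuity of the resolvent turns the vanishing differences into a fixed point
    equation for the cluster point.\<close>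
  have "(\<lambda>k. z (f k) - resolvent T (z (f k))) \<longlonglongrightarrow> w - resolvent T w"
    using f(2) by (intro tendsto_diff isCont_tendsto_compose[OF continuous_resolvent]) (auto simp: o_def)
  moreover have "(\<lambda>k. z (f k) - resolvent T (z (f k))) \<longlonglongrightarrow> 0"
    using LIMSEQ_subseq_LIMSEQ[OF diff f(1)] by (simp add: o_def)
  ultimately have "w - resolvent T w = 0" by (rule LIMSEQ_unique)
  then have w: "0 \<in> T w" by (simp add: resolvent_fixpoint_iff[symmetric])
  have "(\<lambda>k. norm (z k - w)) \<longlonglongrightarrow> 0"
  proof (rule LIMSEQ_I)
    fix e :: real assume "0 < e"
    then obtain N where "\<And>n. n \<ge> N \<Longrightarrow> norm ((z \<circ> f) n - w) < e"
      using LIMSEQ_D[OF f(2)] by blast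
    then have "norm (z (f N) - w) < e" by simp
    then show "\<exists>no. \<forall>n\<ge>no. norm (norm (z n - w) - 0) < e"
      using decseqD[OF decreasing[OF w]]
      by (intro exI[of _ "f N"]) (auto intro: order.strict_trans1)
  qed
  then have "z \<longlonglongrightarrow> w" by (simp add: tendsto_norm_zero_iff LIM_zero_iff)
  with w show ?thesis by blast
qed

end

lemma maximal_monotone_saddle_op:
  assumes "saddle_function L" "proper_saddle L"
  shows "maximal_monotone (saddle_op L)"
  using saddle_op_monotone[OF assms(2)] saddle_op_range[OF assms] by (rule maximal_monotone.intro)

section \<open>Orthogonal blocks and the Jacobi iteration\<close>

lemma block_component_properties:
  assumes "subspace W"
  shows "block_component W z \<in> W \<and> z - block_component W z \<in> W\<^sup>\<bottom>"
  unfolding block_component_def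
proof (rule theI')
  obtain p q where pq: "p \<in> span W" "\<And>w. w \<in> span W \<Longrightarrow> orthogonal q w" "z = p + q"
    using orthogonal_subspace_decomp_exists[of W z] by blast
  have W: "span W = W" using assms by (simp add: span_eq_iff)
  show "\<exists>!w. w \<in> W \<and> z - w \<in> W\<^sup>\<bottom>"
  proof (rule ex1I[of _ p])
    show "p \<in> W \<and> z - p \<in> W\<^sup>\<bottom>"
      using pq W by (auto simp: orthogonal_comp_def orthogonal_commute)
  next
    fix w assume w: "w \<in> W \<and> z - w \<in> W\<^sup>\<bottom>"
    have "p - w \<in> W" using assms pq(1) w W by (simp add: subspace_diff)
    then have "orthogonal (p - w) (z - w)" "orthogonal (p - w) q"
      using w pq(2) W orthogonal_commute[of q "p - w"] by (auto simp: orthogonal_comp_def)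
    \<comment> \<open>Since \<open>(z - w) - q\<close> equals \<open>p - w\<close>, the difference
      of the two candidates is orthogonal to itself.\<close>
    then have "orthogonal (p - w) ((z - w) - q)" by (rule orthogonal_clauses)
    then show "w = p" by (simp add: pq(3) orthogonal_def)
  qed
qed

text \<open>Equal components make \<open>z - z'\<close> a difference of residuals, orthogonal to
  every block; as the blocks span the space, it is orthogonal to itself.\<close>

lemma block_components_eqD:
  assumes V: "block_decomposition \<alpha> V"
    and eq: "\<And>i. i \<in> {1..\<alpha>} \<Longrightarrow> block_component (V i) z = block_component (V i) z'"
  shows "z = z'"
proof -
  have "orthogonal (z - z') v" if i: "i \<in> {1..\<alpha>}" and v: "v \<in> V i" for i v
  proof -
    have "subspace (V i)" using V i by (auto simp: block_decomposition_def)
    then have "orthogonal v (z - block_component (V i) z)" "orthogonal v (z' - block_component (V i) z')"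
      using block_component_properties v by (auto simp: orthogonal_comp_def)
    then have "orthogonal v ((z - block_component (V i) z) - (z' - block_component (V i) z'))"
      by (rule orthogonal_clauses)
    then show ?thesis using eq[OF i] by (simp add: orthogonal_commute)
  qed
  then have "orthogonal (z - z') v" if "v \<in> (\<Union>i\<in>{1..\<alpha>}. V i)" for v
    using that by blast
  moreover have "z - z' \<in> span (\<Union>i\<in>{1..\<alpha>}. V i)"
    using V unfolding block_decomposition_def by blast
  ultimately have "orthogonal (z - z') (z - z')" by (rule orthogonal_to_span[rotated])
  then show ?thesis by (simp add: orthogonal_self)
qed

theorem corollary6:
  fixes L :: "(real ^ 'n) \<Rightarrow> (real ^ 'p) \<Rightarrow> ereal"
    and \<alpha> :: nat
    and V :: "nat \<Rightarrow> ((real ^ 'n) \<times> (real ^ 'p)) set"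
    and z0 :: "(real ^ 'n) \<times> (real ^ 'p)"
    and z :: "nat \<Rightarrow> (real ^ 'n) \<times> (real ^ 'p)"
  assumes "saddle_function L"
    and "proper_saddle L"
    and "\<exists>w. saddle_point L w"
    and "block_decomposition \<alpha> V"
    and "z 0 = z0"
    and "parallel_jacobi \<alpha> V (resolvent (saddle_op L)) z"
  shows "\<exists>w. saddle_point L w \<and> z \<longlonglongrightarrow> w"
proof -
  interpret maximal_monotone "saddle_op L"
    using assms(1,2) by (rule maximal_monotone_saddle_op)
  have step: "z (Suc k) = resolvent (saddle_op L) (z k)" for k
  proof (rule block_components_eqD[OF assms(4)])
    fix i assume "i \<in> {1..\<alpha>}"
    then show "block_component (V i) (z (Suc k)) = block_component (V i) (resolvent (saddle_op L) (z k))"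
      using assms(6) unfolding parallel_jacobi_def by blast
  qed
  obtain w0 where "0 \<in> saddle_op L w0"
    using assms(3) unfolding saddle_point_iff by blast
  then show ?thesis
    unfolding saddle_point_iff by (rule proximal_point_iteration_converges[where z = z, OF step])
qed

end
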